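(* Let $I$ and $J$ be ideals in the polynomial ring $R$ such that $J$ is generated by an $R/I$-regular sequence $g_1,g_2,\ldots,g_k$ (of elements of $R$). Then: (i) $I\cap J=IJ$; (ii) $I\cap J^r=IJ^r$ for all positive integers $r$.
   Context: $K$ is a field, $n\ge 2$, and $R=K[x_{ij},y_j\mid 1\le i,j\le n]$ is a polynomial ring. An $R/I$-regular sequence is a sequence $g_1,\dots,g_k\in R$ that is a regular sequence on the $R$-module $R/I$. *)

theory Defs
  imports
    "HOL-Algebra.Algebra"
    "HOL-Algebra.Algebraic_Closure_Type"
    "HOL-Library.Poly_Mapping"
    "HOL-Library.Cardinality"
begin

section \<open>The polynomial ring in the variables $x_{ij}$ and $y_j$\<close>

text \<open>
  The indices range over a finite type, whose cardinality plays the role of $n$. A polynomial is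
  a finitely supported map from monomials to coefficients, and a monomial is a finitely supported
  map from variables to exponents; multiplication on \<^typ>\<open>('v \<Rightarrow>\<^sub>0 nat) \<Rightarrow>\<^sub>0 'k::field\<close>
  is the usual (convolution) product of polynomials.
\<close>

datatype 'n xy_var = X 'n 'n | Y 'n

type_synonym ('n, 'k) xy_poly = "('n xy_var \<Rightarrow>\<^sub>0 nat) \<Rightarrow>\<^sub>0 'k"

definition xy_ring :: "('n::finite, 'k::field) xy_poly ring"
  where "xy_ring = ring_of_type_algebra"

lemma cring_xy_ring: "cring (xy_ring :: ('n::finite, 'k::field) xy_poly ring)"
  unfolding xy_ring_def by (rule cring_from_type_algebra)


section \<open>Quotient modules\<close>

definition self_module :: "('a, 'c) ring_scheme \<Rightarrow> ('a, 'a) module"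
  where "self_module R =
    \<lparr>carrier = carrier R, monoid.mult = monoid.mult R, monoid.one = \<one>\<^bsub>R\<^esub>,
     ring.zero = \<zero>\<^bsub>R\<^esub>, add = add R, module.smult = monoid.mult R\<rparr>"

text \<open>
  The record type of modules extends that of rings, but its fields for multiplication and one are
  irrelevant to the module structure; they are left unspecified here.
\<close>

definition quot_module :: "('a, 'b, 'c) module_scheme \<Rightarrow> 'b set \<Rightarrow> ('a, 'b set) module"
  where "quot_module M N =
    \<lparr>carrier = a_rcosets\<^bsub>M\<^esub> N, monoid.mult = undefined, monoid.one = undefined,
     ring.zero = N, add = set_add M,
     module.smult = (\<lambda>a C. \<Union>x\<in>C. N +>\<^bsub>M\<^esub> (a \<odot>\<^bsub>M\<^esub> x))\<rparr>"

lemma (in cring) self_module_is_module: "Module.module R (self_module R)"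
proof (rule moduleI)
  show "abelian_group (self_module R)"
    by (rule abelian_groupI)
      (auto simp: self_module_def a_ac intro: l_neg)
qed (auto simp: self_module_def is_cring l_distr r_distr m_assoc)

lemma (in cring) submodule_self_module_iff:
  "submodule I R (self_module R) \<longleftrightarrow> ideal I R"
proof
  assume I: "submodule I R (self_module R)"
  show "ideal I R"
  proof (rule idealI)
    show "subgroup I (add_monoid R)"
      using submodule.axioms(1)[OF I] by (auto simp: self_module_def subgroup_def m_inv_def)
    show l: "x \<otimes> a \<in> I" if "a \<in> I" "x \<in> carrier R" for a x
      using submodule.smult_closed[OF I] that by (simp add: self_module_def)
    show "a \<otimes> x \<in> I" if "a \<in> I" "x \<in> carrier R" for a x
      using l[OF that] that subgroup.subset[OF \<open>subgroup I (add_monoid R)\<close>]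
      by (auto simp: m_comm subset_iff)
  qed (rule ring_axioms)
next
  assume I: "ideal I R"
  then interpret ideal I R .
  show "submodule I R (self_module R)"
    using a_subgroup by (intro submodule.intro)
      (auto simp: self_module_def submodule_axioms_def subgroup_def m_inv_def I_l_closed)
qed

lemma (in Module.module) abelian_subgroup_submodule:
  assumes "submodule N R M"
  shows "abelian_subgroup N M"
  by (rule abelian_subgroupI3)
    (use submodule.axioms(1)[OF assms] M.abelian_group_axioms in
      \<open>auto simp: additive_subgroup_def\<close>)

lemma (in Module.module) quot_module_smult_coset:
  assumes N: "submodule N R M" and a: "a \<in> carrier R" and x: "x \<in> carrier M"
  shows "a \<odot>\<^bsub>quot_module M N\<^esub> (N +>\<^bsub>M\<^esub> x) = N +>\<^bsub>M\<^esub> (a \<odot>\<^bsub>M\<^esub> x)"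
proof -
  interpret N: abelian_subgroup N M
    using N by (rule abelian_subgroup_submodule)
  have "N +>\<^bsub>M\<^esub> (a \<odot>\<^bsub>M\<^esub> y) = N +>\<^bsub>M\<^esub> (a \<odot>\<^bsub>M\<^esub> x)" if y: "y \<in> N +>\<^bsub>M\<^esub> x" for y
  proof -
    obtain h where h: "h \<in> N" "y = h \<oplus>\<^bsub>M\<^esub> x"
      using y by (auto simp: a_r_coset_def')
    have hM: "h \<in> carrier M" using h(1) by simp
    have "a \<odot>\<^bsub>M\<^esub> y = a \<odot>\<^bsub>M\<^esub> h \<oplus>\<^bsub>M\<^esub> a \<odot>\<^bsub>M\<^esub> x"
      using a x hM by (simp add: h smult_r_distr)
    moreover have "a \<odot>\<^bsub>M\<^esub> h \<in> N"
      using submodule.smult_closed[OF N a h(1)] .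
    ultimately have "a \<odot>\<^bsub>M\<^esub> y \<in> N +>\<^bsub>M\<^esub> (a \<odot>\<^bsub>M\<^esub> x)"
      unfolding a_r_coset_def' by blast
    then show ?thesis
      using N.a_repr_independence'[of "a \<odot>\<^bsub>M\<^esub> y" "a \<odot>\<^bsub>M\<^esub> x"] a x by simp
  qed
  moreover have "x \<in> N +>\<^bsub>M\<^esub> x" using x by (rule N.a_rcos_self)
  ultimately have "(\<Union>y\<in>N +>\<^bsub>M\<^esub> x. N +>\<^bsub>M\<^esub> (a \<odot>\<^bsub>M\<^esub> y)) = N +>\<^bsub>M\<^esub> (a \<odot>\<^bsub>M\<^esub> x)"
    by blast
  then show ?thesis by (simp add: quot_module_def)
qed

lemma (in Module.module) quot_module_is_module:
  assumes N: "submodule N R M"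
  shows "Module.module R (quot_module M N)"
proof -
  interpret N: abelian_subgroup N M
    using N by (rule abelian_subgroup_submodule)
  have coset: "\<exists>x\<in>carrier M. C = N +>\<^bsub>M\<^esub> x" if "C \<in> carrier (quot_module M N)" for C
    using that by (auto simp: quot_module_def A_RCOSETS_def')
  have in_coset: "N +>\<^bsub>M\<^esub> x \<in> carrier (quot_module M N)" if "x \<in> carrier M" for x
    using that by (auto simp: quot_module_def A_RCOSETS_def')
  have plus: "(N +>\<^bsub>M\<^esub> x) \<oplus>\<^bsub>quot_module M N\<^esub> (N +>\<^bsub>M\<^esub> y) = N +>\<^bsub>M\<^esub> (x \<oplus>\<^bsub>M\<^esub> y)"
    if "x \<in> carrier M" "y \<in> carrier M" for x y
    using that by (simp add: quot_module_def N.a_rcos_sum)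
  have zero: "\<zero>\<^bsub>quot_module M N\<^esub> = N +>\<^bsub>M\<^esub> \<zero>\<^bsub>M\<^esub>"
    using N.a_rcos_const[of "\<zero>\<^bsub>M\<^esub>"] N.zero_closed by (simp add: quot_module_def)
  note smult = quot_module_smult_coset[OF N]
  show ?thesis
  proof (rule moduleI)
    show "abelian_group (quot_module M N)"
    proof (rule abelian_groupI)
      fix C assume "C \<in> carrier (quot_module M N)"
      then obtain x where x: "x \<in> carrier M" "C = N +>\<^bsub>M\<^esub> x" using coset by blast
      show "\<exists>D\<in>carrier (quot_module M N). D \<oplus>\<^bsub>quot_module M N\<^esub> C = \<zero>\<^bsub>quot_module M N\<^esub>"
        by (rule bexI[of _ "N +>\<^bsub>M\<^esub> (\<ominus>\<^bsub>M\<^esub> x)"]) (use x in \<open>simp_all add: plus zero in_coset M.l_neg\<close>)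
    qed (auto dest!: coset simp: plus zero in_coset M.a_ac)
  qed (auto dest!: coset simp: plus smult in_coset smult_l_distr smult_r_distr smult_assoc1 is_cring)
qed


section \<open>Regular sequences on a module\<close>

text \<open>
  \<open>ideal_smult R M A\<close> is the submodule $A M$ generated by all products $a x$ with
  $a \in A$ and $x \in M$.
\<close>

definition ideal_smult ::
    "('a, 'd) ring_scheme \<Rightarrow> ('a, 'b, 'c) module_scheme \<Rightarrow> 'a set \<Rightarrow> 'b set"
  where "ideal_smult R M A =
    \<Inter>{N. submodule N R M \<and> (\<forall>a\<in>A. \<forall>x\<in>carrier M. a \<odot>\<^bsub>M\<^esub> x \<in> N)}"

lemma (in Module.module) ideal_smult_is_submodule:
  assumes "A \<subseteq> carrier R"
  shows "submodule (ideal_smult R M A) R M"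
proof -
  let ?S = "{N. submodule N R M \<and> (\<forall>a\<in>A. \<forall>x\<in>carrier M. a \<odot>\<^bsub>M\<^esub> x \<in> N)}"
  have carr: "carrier M \<in> ?S"
    using carrier_is_submodule assms by auto
  have "subgroup (\<Inter>?S) (add_monoid M)"
    by (rule add.subgroups_Inter) (use carr in \<open>auto dest: submodule.axioms(1)\<close>)
  then show ?thesis
    unfolding ideal_smult_def
    by (intro submodule.intro) (auto simp: submodule_axioms_def dest: submodule.smult_closed)
qed

definition nonzerodivisor_on :: "('a, 'b, 'c) module_scheme \<Rightarrow> 'a \<Rightarrow> bool"
  where "nonzerodivisor_on M a \<longleftrightarrow>
    (\<forall>x\<in>carrier M. a \<odot>\<^bsub>M\<^esub> x = \<zero>\<^bsub>M\<^esub> \<longrightarrow> x = \<zero>\<^bsub>M\<^esub>)"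

text \<open>
  As usual, a regular sequence $g_1,\dots,g_k$ on $M$ is required to satisfy
  $M \neq (g_1,\dots,g_k) M$ in addition to $g_i$ being a nonzerodivisor on
  $M / (g_1,\dots,g_{i-1}) M$ for all $i$. The list \<open>gs\<close> is indexed from 0, so
  \<open>take i gs\<close> consists of the elements strictly before \<open>gs ! i\<close>.
\<close>

definition regular_sequence ::
    "('a, 'd) ring_scheme \<Rightarrow> ('a, 'b, 'c) module_scheme \<Rightarrow> 'a list \<Rightarrow> bool"
  where "regular_sequence R M gs \<longleftrightarrow>
    set gs \<subseteq> carrier R \<and>
    (\<forall>i<length gs. nonzerodivisor_on
       (quot_module M (ideal_smult R M (Idl\<^bsub>R\<^esub> (set (take i gs))))) (gs ! i)) \<and>
    carrier M \<noteq> ideal_smult R M (Idl\<^bsub>R\<^esub> (set gs))"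

end

theory Submission
  imports Defs
begin

text \<open>
  Let $R$ be a commutative ring in which each $g_i$ is a nonzerodivisor modulo
  $I + (g_1,\dots,g_{i-1})$. Write $J' = (g_1,\dots,g_{k-1})$ and $g = g_k$.
  Every power of $J$ splits off the last generator, $J^{r+1} = J'^{r+1} + g J^r$, and this drives
  inductions on the length of the sequence and, inside, on the exponent.

  For $f \in I \cap J^{r+1}$ write $f = a + g b$ with $a \in J'^{r+1}$ and $b \in J^r$. Then
  $g b \in I + J'^{r+1}$, so if $g$ is a nonzerodivisor modulo $I + J'^{r+1}$, we get $b = c + d$
  with $c \in I$ and $d \in J'^{r+1}$. Now $c = b - d \in I \cap J^r = I J^r$ by induction on $r$,
  hence $g c \in I J^{r+1}$, and $a + g d = f - g c \in I \cap J'^{r+1} = I J'^{r+1}$ by induction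
  on the length. So $f \in I J^{r+1}$ (\<open>inter_ideal_pow_eq_prod\<close>).

  What remains is that an element which is a nonzerodivisor modulo $I + J$ is one modulo every
  $I + J^r$ (\<open>nonzerodivisor_mod_ideal_pow\<close>). Climbing from $r$ to $r+1$ needs it to act injectively
  on the image of $J^r$ in $R/(I + J^{r+1})$. The usual reason is that the associated graded module
  of $R/I$ is free over $R/(I+J)$ in each degree. One consequence of that freeness can be proved
  directly by induction: for every ideal $K \supseteq I + J$, an $h$ that is a nonzerodivisor on
  $R/K$ is one on the image of $J^r$ in $R/(I + K J^r)$ (\<open>nonzerodivisor_mod_ideal_pow_layer\<close>).
  The freedom in $K$ makes this induction close: when $J$ is replaced by $J'$, the same $K$ can be
  kept, and then $g \in K$ lets the multiples of $g$ be absorbed.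
\<close>

(* The symbol <+> is reserved for sums of ideals; it also denotes disjoint sums of sets. *)
no_notation Sum_Type.Plus (infixr \<open><+>\<close> 65)

context cring
begin

section \<open>Sums, products and powers of ideals\<close>

abbreviation ideal_pow :: "'a set \<Rightarrow> nat \<Rightarrow> 'a set"
  where "ideal_pow J r \<equiv> J [^]\<^bsub>ideals_set R\<^esub> r"

lemma ideal_pow_0: "ideal_pow J 0 = carrier R"
  by (simp add: ideals_set_def)

lemma ideal_pow_Suc: "ideal_pow J (Suc r) = ideal_pow J r \<cdot> J"
  by (simp add: ideals_set_def)

(* Powers in the monoid of ideals are unfolded by the two equations above, whose right-hand sides
   do not mention the record of ideals. *)
declare Group.nat_pow_0 [simp del] Group.nat_pow_Suc [simp del]

lemma ideal_ideal_pow: "ideal J R \<Longrightarrow> ideal (ideal_pow J r) R"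
  by (induction r) (simp_all add: ideal_pow_0 ideal_pow_Suc oneideal ideal_prod_is_ideal)

lemma ideal_prod_mono:
  assumes "A \<subseteq> A'" "B \<subseteq> B'"
  shows "A \<cdot> B \<subseteq> A' \<cdot> B'"
proof
  fix x assume "x \<in> A \<cdot> B"
  then show "x \<in> A' \<cdot> B'"
    by induction (use assms in \<open>auto intro: ideal_prod.intros\<close>)
qed

lemma ideal_pow_mono: "A \<subseteq> B \<Longrightarrow> ideal_pow A r \<subseteq> ideal_pow B r"
  by (induction r) (simp_all add: ideal_pow_0 ideal_pow_Suc ideal_prod_mono)

lemma ideal_pow_Suc_subset:
  "ideal J R \<Longrightarrow> ideal_pow J (Suc r) \<subseteq> ideal_pow J r"
  using ideal_prod_inter[OF ideal_ideal_pow] by (auto simp: ideal_pow_Suc)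

lemma ideal_plus_closed: "ideal A R \<Longrightarrow> a \<in> A \<Longrightarrow> b \<in> A \<Longrightarrow> a \<oplus> b \<in> A"
  by (simp add: additive_subgroup.a_closed ideal.axioms(1))

lemma ideal_minus_closed: "ideal A R \<Longrightarrow> a \<in> A \<Longrightarrow> b \<in> A \<Longrightarrow> a \<ominus> b \<in> A"
  by (simp add: a_minus_def additive_subgroup.a_closed additive_subgroup.a_inv_closed
      ideal.axioms(1))

lemma mem_set_add_iff: "x \<in> A <+> B \<longleftrightarrow> (\<exists>a\<in>A. \<exists>b\<in>B. x = a \<oplus> b)"
  by (auto simp: set_add_def')

lemma ideal_sum_upper:
  assumes "ideal A R" "ideal B R"
  shows "A \<subseteq> A <+> B" and "B \<subseteq> A <+> B"
  using genideal_self[of "A \<union> B"] union_genideal[OF assms] assms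
  by (auto dest: ideal.Icarr)

lemma ideal_sum_least: "ideal C R \<Longrightarrow> A \<subseteq> C \<Longrightarrow> B \<subseteq> C \<Longrightarrow> A <+> B \<subseteq> C"
  by (auto simp: mem_set_add_iff intro!: ideal_plus_closed dest: subsetD)

lemma ideal_sum_mono: "A \<subseteq> A' \<Longrightarrow> B \<subseteq> B' \<Longrightarrow> A <+> B \<subseteq> A' <+> B'"
  unfolding mem_set_add_iff subset_iff by blast

lemma mem_cgenideal_prodE:
  assumes "ideal A R" "g \<in> carrier R" "x \<in> (PIdl g) \<cdot> A"
  obtains a where "a \<in> A" "x = g \<otimes> a"
proof -
  interpret A: ideal A R by fact
  from assms(3) have "\<exists>a\<in>A. x = g \<otimes> a"
  proof induction
    case (prod i j)
    then obtain y where "y \<in> carrier R" "i = y \<otimes> g" by (auto simp: cgenideal_def)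
    then show ?case
      using prod assms(2) by (intro bexI[of _ "y \<otimes> j"]) (simp_all add: A.I_r_closed A.I_l_closed m_ac)
  next
    case (sum s t)
    then show ?case using assms(2) by (metis A.Icarr A.a_closed r_distr)
  qed
  with that show thesis by blast
qed

lemma genideal_snoc:
  assumes "set gs \<subseteq> carrier R" "g \<in> carrier R"
  shows "Idl (set (gs @ [g])) = Idl (set gs) <+> PIdl g"
proof (rule subset_antisym)
  note id = genideal_ideal[OF assms(1)] cgenideal_ideal[OF assms(2)]
  show "Idl (set (gs @ [g])) \<subseteq> Idl (set gs) <+> PIdl g"
    using ideal_sum_upper[OF id] genideal_self[OF assms(1)] cgenideal_self[OF assms(2)]
    by (intro genideal_minimal add_ideals id) auto
  have id': "ideal (Idl (set (gs @ [g]))) R"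
    and gen: "set (gs @ [g]) \<subseteq> Idl (set (gs @ [g]))"
    using assms by (auto intro!: genideal_ideal genideal_self[THEN subsetD])
  show "Idl (set gs) <+> PIdl g \<subseteq> Idl (set (gs @ [g]))"
    using gen by (intro ideal_sum_least id' genideal_minimal cgenideal_minimal) auto
qed

section \<open>Splitting off a principal summand from powers of an ideal\<close>

text \<open>
  In the expansion of $(J + (g))^{r+1}$ every product that is not purely from $J$ has a factor $g$,
  and the remaining $r$ factors still lie in $J + (g)$.
\<close>

lemma ideal_pow_sum_principal_subset:
  assumes J: "ideal J R" and g: "g \<in> carrier R"
  shows "ideal_pow (J <+> PIdl g) (Suc r)
    \<subseteq> ideal_pow J (Suc r) <+> (PIdl g) \<cdot> ideal_pow (J <+> PIdl g) r"
proof (induction r)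
  case 0
  have "ideal (PIdl g) R" using g by (rule cgenideal_ideal)
  then show ?case
    using J by (simp add: ideal_pow_0 ideal_pow_Suc ideal_prod_one add_ideals
        ideal_prod_commute[OF oneideal])
next
  case (Suc r)
  let ?P = "PIdl g" and ?S = "J <+> PIdl g"
  have P: "ideal ?P R" using g by (rule cgenideal_ideal)
  have S: "ideal ?S R" using J P by (rule add_ideals)
  note id = J P S ideal_ideal_pow[OF J] ideal_ideal_pow[OF S]
  let ?T = "ideal_pow J (Suc (Suc r)) <+> ?P \<cdot> ideal_pow ?S (Suc r)"
  have T: "ideal ?T R" by (intro add_ideals ideal_prod_is_ideal id)
  note up = ideal_sum_upper[of "ideal_pow J (Suc (Suc r))" "?P \<cdot> ideal_pow ?S (Suc r)",
      OF id(4) ideal_prod_is_ideal[OF P id(5)]]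
  have "ideal_pow ?S (Suc (Suc r)) = ideal_pow ?S (Suc r) \<cdot> J <+> ideal_pow ?S (Suc r) \<cdot> ?P"
    unfolding ideal_pow_Suc[of _ "Suc r"] by (rule ideal_prod_distr) (intro id)+
  also have "\<dots> \<subseteq> ?T"
  proof (rule ideal_sum_least[OF T])
    have "ideal_pow ?S (Suc r) \<cdot> J \<subseteq> (ideal_pow J (Suc r) <+> ?P \<cdot> ideal_pow ?S r) \<cdot> J"
      by (intro ideal_prod_mono Suc.IH order_refl)
    also have "\<dots> = ideal_pow J (Suc (Suc r)) <+> ?P \<cdot> (ideal_pow ?S r \<cdot> J)"
      by (subst ideal_prod_distr(2))
        (simp_all add: id ideal_prod_is_ideal ideal_prod_assoc ideal_pow_Suc[of _ "Suc r"])
    also have "\<dots> \<subseteq> ?T"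
      unfolding ideal_pow_Suc[of ?S r]
      by (intro ideal_sum_mono ideal_prod_mono order_refl ideal_sum_upper(1) J P)
    finally show "ideal_pow ?S (Suc r) \<cdot> J \<subseteq> ?T" .
    have "ideal_pow ?S (Suc r) \<cdot> ?P = ?P \<cdot> ideal_pow ?S (Suc r)"
      by (rule ideal_prod_commute) (intro id)+
    then show "ideal_pow ?S (Suc r) \<cdot> ?P \<subseteq> ?T"
      using up by simp
  qed
  finally show ?case .
qed

lemma mem_ideal_pow_snocE:
  assumes "ideal J R" "g \<in> carrier R" "x \<in> ideal_pow (J <+> PIdl g) (Suc r)"
  obtains b c where "b \<in> ideal_pow J (Suc r)" "c \<in> ideal_pow (J <+> PIdl g) r" "x = b \<oplus> g \<otimes> c"
proof -
  from ideal_pow_sum_principal_subset[OF assms(1,2)] assms(3)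
  obtain b p where "b \<in> ideal_pow J (Suc r)" "p \<in> (PIdl g) \<cdot> ideal_pow (J <+> PIdl g) r"
      "x = b \<oplus> p"
    unfolding subset_iff mem_set_add_iff by blast
  then show thesis
    using that mem_cgenideal_prodE[OF ideal_ideal_pow[OF add_ideals] assms(2)] assms(1,2)
      cgenideal_ideal by metis
qed

lemma mem_prod_ideal_pow_snocE:
  assumes K: "ideal K R" and J: "ideal J R" and g: "g \<in> carrier R"
    and x: "x \<in> K \<cdot> ideal_pow (J <+> PIdl g) (Suc r)"
  obtains b c where "b \<in> K \<cdot> ideal_pow J (Suc r)" "c \<in> K \<cdot> ideal_pow (J <+> PIdl g) r"
    "x = b \<oplus> g \<otimes> c"
proof -
  let ?S = "J <+> PIdl g"
  have P: "ideal (PIdl g) R" using g by (rule cgenideal_ideal)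
  have S: "ideal ?S R" using J P by (rule add_ideals)
  note id = K P ideal_ideal_pow[OF J] ideal_ideal_pow[OF S]
  have "x \<in> K \<cdot> (ideal_pow J (Suc r) <+> (PIdl g) \<cdot> ideal_pow ?S r)"
    using ideal_prod_mono[OF order_refl ideal_pow_sum_principal_subset[OF J g]] x by blast
  also have "\<dots> = K \<cdot> ideal_pow J (Suc r) <+> (PIdl g) \<cdot> (K \<cdot> ideal_pow ?S r)"
    by (simp add: ideal_prod_distr id ideal_prod_is_ideal ideal_prod_assoc[symmetric]
        ideal_prod_commute[OF K P])
  finally obtain b p where "b \<in> K \<cdot> ideal_pow J (Suc r)" "p \<in> (PIdl g) \<cdot> (K \<cdot> ideal_pow ?S r)"
      "x = b \<oplus> p"
    by (auto simp: mem_set_add_iff)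
  then show thesis
    using that mem_cgenideal_prodE[OF ideal_prod_is_ideal[OF K id(4)] g] by metis
qed

section \<open>Nonzerodivisors modulo powers of an ideal\<close>

definition nonzerodivisor_mod :: "'a set \<Rightarrow> 'a \<Rightarrow> bool"
  where "nonzerodivisor_mod K h \<longleftrightarrow> (\<forall>a\<in>carrier R. h \<otimes> a \<in> K \<longrightarrow> a \<in> K)"

definition weakly_regular_mod :: "'a set \<Rightarrow> 'a list \<Rightarrow> bool"
  where "weakly_regular_mod I gs \<longleftrightarrow>
    (\<forall>i<length gs. nonzerodivisor_mod (I <+> Idl (set (take i gs))) (gs ! i))"

lemma weakly_regular_mod_snoc:
  "weakly_regular_mod I (gs @ [g]) \<longleftrightarrow>
    weakly_regular_mod I gs \<and> nonzerodivisor_mod (I <+> Idl (set gs)) g"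
  by (auto simp: weakly_regular_mod_def nth_append less_Suc_eq)

text \<open>
  The submodules $(I + J^r)/I$ filter $R/I$. If multiplication by $h$ is injective on each layer
  $(I + J^r)/(I + J^{r+1})$ of this filtration, then it is injective on $R/(I + J^r)$ for all $r$.
  The layers are written with $I + (I+J)J^r$, which equals $I + J^{r+1}$, because that is the
  form that generalises to other ideals in place of $I + J$.
\<close>

lemma nonzerodivisor_mod_sum_pow:
  assumes I: "ideal I R" and J: "ideal J R" and h: "h \<in> carrier R"
    and layer: "\<And>r a. a \<in> ideal_pow J r \<Longrightarrow> h \<otimes> a \<in> I <+> (I <+> J) \<cdot> ideal_pow J r
      \<Longrightarrow> a \<in> I <+> (I <+> J) \<cdot> ideal_pow J r"
  shows "nonzerodivisor_mod (I <+> ideal_pow J r) h"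
proof (induction r)
  case 0
  show ?case
    using ideal_sum_upper(2)[OF I oneideal]
    by (auto simp: nonzerodivisor_mod_def ideal_pow_0)
next
  case (Suc r)
  note pow = ideal_ideal_pow[OF J]
  have IJ: "ideal (I <+> J) R" using I J by (rule add_ideals)
  have "J \<cdot> ideal_pow J r = ideal_pow J (Suc r)"
    by (simp add: ideal_pow_Suc ideal_prod_commute[OF J pow])
  moreover have "(I <+> J) \<cdot> ideal_pow J r = I \<cdot> ideal_pow J r <+> J \<cdot> ideal_pow J r"
    by (rule ideal_prod_distr) (intro I J pow)+
  ultimately have split: "(I <+> J) \<cdot> ideal_pow J r = I \<cdot> ideal_pow J r <+> ideal_pow J (Suc r)"
    by simp
  have eq: "I <+> (I <+> J) \<cdot> ideal_pow J r = I <+> ideal_pow J (Suc r)"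
  proof (rule subset_antisym)
    have "I \<cdot> ideal_pow J r \<subseteq> I" using ideal_prod_inter[OF I pow] by blast
    then show "I <+> (I <+> J) \<cdot> ideal_pow J r \<subseteq> I <+> ideal_pow J (Suc r)"
      unfolding split using ideal_sum_upper[OF I pow[of "Suc r"]]
      by (intro ideal_sum_least add_ideals I pow) auto
    show "I <+> ideal_pow J (Suc r) \<subseteq> I <+> (I <+> J) \<cdot> ideal_pow J r"
      unfolding split using ideal_sum_upper(2)[OF ideal_prod_is_ideal[OF I pow] pow]
      by (intro ideal_sum_mono order_refl)
  qed
  have T: "ideal (I <+> ideal_pow J (Suc r)) R" by (intro add_ideals I pow)
  show ?case
    unfolding nonzerodivisor_mod_def
  proof (intro ballI impI)
    fix a assume a: "a \<in> carrier R" and ha: "h \<otimes> a \<in> I <+> ideal_pow J (Suc r)"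
    then have "h \<otimes> a \<in> I <+> ideal_pow J r"
      using ideal_sum_mono[OF order_refl ideal_pow_Suc_subset[OF J]] by blast
    with Suc.IH a have "a \<in> I <+> ideal_pow J r" by (simp add: nonzerodivisor_mod_def)
    then obtain i b where i: "i \<in> I" and b: "b \<in> ideal_pow J r" and a_eq: "a = i \<oplus> b"
      by (auto simp: mem_set_add_iff)
    have carr: "i \<in> carrier R" "b \<in> carrier R"
      using i b I pow by (auto dest: ideal.Icarr)
    have iT: "i \<in> I <+> ideal_pow J (Suc r)" using ideal_sum_upper(1)[OF I pow] i by blast
    have "h \<otimes> b = h \<otimes> a \<ominus> h \<otimes> i"
      using carr h unfolding a_eq by algebra
    then have "h \<otimes> b \<in> I <+> ideal_pow J (Suc r)"
      using ideal_minus_closed[OF T ha ideal.I_l_closed[OF T iT h]] by simp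
    then have "b \<in> I <+> ideal_pow J (Suc r)" using layer[OF b] eq by simp
    then show "a \<in> I <+> ideal_pow J (Suc r)"
      unfolding a_eq using iT by (intro ideal_plus_closed[OF T])
  qed
qed

lemma ideal_pow_Suc_genideal_empty: "ideal_pow (Idl {}) (Suc r) \<subseteq> {\<zero>}"
proof -
  have J: "ideal (Idl {}) R" by (simp add: genideal_ideal)
  have "ideal_pow (Idl {}) (Suc r) \<subseteq> Idl {}"
    using ideal_prod_inter[OF ideal_ideal_pow[OF J] J] unfolding ideal_pow_Suc by blast
  also have "\<dots> \<subseteq> {\<zero>}" by (intro genideal_minimal zeroideal) simp
  finally show ?thesis .
qed

lemma sum_prod_ideal_pow_0:
  assumes "ideal I R" "ideal K R" "I \<subseteq> K"
  shows "I <+> K \<cdot> ideal_pow J 0 = K"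
  using ideal_sum_upper(2)[OF assms(1,2)] ideal_sum_least[OF assms(2,3) order_refl]
  unfolding ideal_pow_0 ideal_prod_one[OF assms(2)] by blast

text \<open>
  Write $J = J' + (g)$ with $g$ the last generator, and $a = b + g c$ with $b \in J'^{r+1}$ and
  $c \in J^r$. Collecting the multiples of $g$ in the hypothesis on $h a$ leaves
  $h b + g w \in I + K J'^{r+1}$ for some $w \equiv h c$ modulo $K J^r$. By the case of $J'$,
  applied to $g$ in place of $h$ and $I + J'$ in place of $K$, the element $g$ may be cancelled
  modulo $I + J'^{r+1}$, so that $w \in I + J'^{r+1}$. This has two consequences. First,
  $h c \in I + K J^r$, because $J'^{r+1} \subseteq K J^r$; this settles $c$ by induction on $r$.
  Second, as $g \in K$, also $g w \in I + K J'^{r+1}$, so $h b \in I + K J'^{r+1}$; this settles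
  $b$ by induction on the sequence.
\<close>

lemma nonzerodivisor_mod_ideal_pow_layer:
  assumes I: "ideal I R" and "set gs \<subseteq> carrier R" "weakly_regular_mod I gs"
    and "ideal K R" "I \<subseteq> K" "set gs \<subseteq> K"
    and "h \<in> carrier R" "nonzerodivisor_mod K h"
    and "a \<in> ideal_pow (Idl (set gs)) r"
    and "h \<otimes> a \<in> I <+> K \<cdot> ideal_pow (Idl (set gs)) r"
  shows "a \<in> I <+> K \<cdot> ideal_pow (Idl (set gs)) r"
  using assms(2-)
proof (induction gs arbitrary: K h r a rule: rev_induct)
  case Nil
  show ?case
  proof (cases r)
    case 0
    note layer0 = sum_prod_ideal_pow_0[OF I \<open>ideal K R\<close> \<open>I \<subseteq> K\<close>]
    have "a \<in> carrier R" using Nil.prems(8) by (simp only: 0 ideal_pow_0)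
    then show ?thesis
      using Nil.prems(7,9) unfolding 0 layer0 nonzerodivisor_mod_def by blast
  next
    case (Suc m)
    have J: "ideal (Idl {}) R" by (simp add: genideal_ideal)
    have "a = \<zero>"
      using Nil.prems(8) ideal_pow_Suc_genideal_empty[of m] by (auto simp: Suc)
    moreover have "ideal (I <+> K \<cdot> ideal_pow (Idl {}) r) R"
      by (intro add_ideals I ideal_prod_is_ideal Nil ideal_ideal_pow J)
    ultimately show ?thesis
      by (simp add: additive_subgroup.zero_closed ideal.axioms(1))
  qed
next
  case (snoc g gs)
  let ?J' = "Idl (set gs)" and ?J = "Idl (set (gs @ [g]))"
  have gs: "set gs \<subseteq> carrier R" and g: "g \<in> carrier R" and gK: "g \<in> K" and gsK: "set gs \<subseteq> K"
    using snoc.prems by auto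
  note K = \<open>ideal K R\<close> and h = \<open>h \<in> carrier R\<close>
  have reg: "weakly_regular_mod I gs" and g_nzd: "nonzerodivisor_mod (I <+> ?J') g"
    using snoc.prems by (auto simp: weakly_regular_mod_snoc)
  have J': "ideal ?J' R" using gs by (rule genideal_ideal)
  have P: "ideal (PIdl g) R" using g by (rule cgenideal_ideal)
  have J_eq: "?J = ?J' <+> PIdl g" using gs g by (rule genideal_snoc)
  have J: "ideal ?J R" unfolding J_eq using J' P by (rule add_ideals)
  have gJ: "g \<in> ?J" using gs g genideal_self[of "set (gs @ [g])"] by auto
  have J'J: "?J' \<subseteq> ?J" unfolding J_eq using J' P by (rule ideal_sum_upper)
  have J'K: "?J' \<subseteq> K" using K gsK by (rule genideal_minimal)
  note pow = ideal_ideal_pow[OF J] and pow' = ideal_ideal_pow[OF J']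
  have g_nzd_pow: "nonzerodivisor_mod (I <+> ideal_pow ?J' r) g" for r
  proof (rule nonzerodivisor_mod_sum_pow[OF I J' g])
    fix r a assume "a \<in> ideal_pow ?J' r" "g \<otimes> a \<in> I <+> (I <+> ?J') \<cdot> ideal_pow ?J' r"
    moreover have "I \<subseteq> I <+> ?J'" "set gs \<subseteq> I <+> ?J'"
      using ideal_sum_upper[OF I J'] genideal_self[OF gs] by blast+
    ultimately show "a \<in> I <+> (I <+> ?J') \<cdot> ideal_pow ?J' r"
      using snoc.IH[OF gs reg add_ideals[OF I J'] _ _ g g_nzd] by blast
  qed
  show ?case
    using snoc.prems(8,9)
  proof (induction r arbitrary: a)
    case 0
    note layer0 = sum_prod_ideal_pow_0[OF I K \<open>I \<subseteq> K\<close>]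
    have "a \<in> carrier R" using 0(1) by (simp only: ideal_pow_0)
    then show ?case
      using 0(2) snoc.prems(7) unfolding layer0 nonzerodivisor_mod_def by blast
  next
    case (Suc r)
    let ?T = "\<lambda>r. I <+> K \<cdot> ideal_pow ?J r" and ?T' = "I <+> K \<cdot> ideal_pow ?J' (Suc r)"
    let ?Q = "I <+> ideal_pow ?J' (Suc r)"
    note KJ = ideal_prod_is_ideal[OF K pow] and KJ' = ideal_prod_is_ideal[OF K pow']
    have T: "ideal (?T r) R" for r by (intro add_ideals I KJ)
    have T': "ideal ?T' R" by (intro add_ideals I KJ')
    have Q: "ideal ?Q R" by (intro add_ideals I pow')
    note upT = ideal_sum_upper[OF I KJ] and upT' = ideal_sum_upper[OF I KJ']
      and upQ = ideal_sum_upper[OF I pow']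
    have T'T: "?T' \<subseteq> ?T (Suc r)"
      by (intro ideal_sum_mono ideal_prod_mono ideal_pow_mono J'J order_refl)
    obtain b c where b: "b \<in> ideal_pow ?J' (Suc r)" and c: "c \<in> ideal_pow ?J r"
      and a_eq: "a = b \<oplus> g \<otimes> c"
      using Suc.prems(1) mem_ideal_pow_snocE[OF J' g] unfolding J_eq by metis
    obtain i k where i: "i \<in> I" and k: "k \<in> K \<cdot> ideal_pow ?J (Suc r)" and ha: "h \<otimes> a = i \<oplus> k"
      using Suc.prems(2) by (auto simp: mem_set_add_iff)
    obtain u m where u: "u \<in> K \<cdot> ideal_pow ?J' (Suc r)" and m: "m \<in> K \<cdot> ideal_pow ?J r"
      and k_eq: "k = u \<oplus> g \<otimes> m"
      using k mem_prod_ideal_pow_snocE[OF K J' g] unfolding J_eq by metis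
    have carr: "b \<in> carrier R" "c \<in> carrier R" "i \<in> carrier R" "u \<in> carrier R" "m \<in> carrier R"
      using ideal.Icarr[OF pow' b] ideal.Icarr[OF pow c] ideal.Icarr[OF I i]
        ideal.Icarr[OF KJ' u] ideal.Icarr[OF KJ m] by blast+
    \<comment> \<open>what \<open>g\<close> is multiplied by once its multiples in \<open>h \<otimes> a = i \<oplus> k\<close> are on the left\<close>
    define w where "w = h \<otimes> c \<ominus> m"
    have w: "w \<in> carrier R" unfolding w_def using carr h by simp
    have key: "h \<otimes> b \<oplus> g \<otimes> w = i \<oplus> u"
    proof -
      have "h \<otimes> b \<oplus> g \<otimes> w = h \<otimes> a \<ominus> g \<otimes> m"
        unfolding w_def a_eq using carr g h by algebra
      also have "\<dots> = i \<oplus> u"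
        unfolding ha k_eq using carr g h by algebra
      finally show ?thesis .
    qed
    have "g \<otimes> w = (i \<oplus> u) \<ominus> h \<otimes> b"
      unfolding key[symmetric] using carr g h w by algebra
    moreover have "u \<in> ideal_pow ?J' (Suc r)"
      using u ideal_prod_inter[OF K pow'] by blast
    ultimately have "g \<otimes> w \<in> ?Q"
      using ideal_minus_closed[OF Q ideal_plus_closed[OF Q subsetD[OF upQ(1) i] subsetD[OF upQ(2)]]
          ideal.I_l_closed[OF Q subsetD[OF upQ(2) b] h]] by simp
    then have wQ: "w \<in> ?Q"
      using g_nzd_pow w by (simp add: nonzerodivisor_mod_def)
    have "ideal_pow ?J' (Suc r) \<subseteq> K \<cdot> ideal_pow ?J r"
      unfolding ideal_pow_Suc ideal_prod_commute[OF pow' J']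
      by (intro ideal_prod_mono ideal_pow_mono J'J J'K)
    then have "w \<in> ?T r"
      using wQ ideal_sum_mono[OF order_refl] by blast
    moreover have "h \<otimes> c = w \<oplus> m"
      unfolding w_def using carr h by algebra
    ultimately have "h \<otimes> c \<in> ?T r"
      using ideal_plus_closed[OF T _ subsetD[OF upT(2) m]] by simp
    then have "c \<in> ?T r" by (rule Suc.IH[OF c])
    then obtain i' m' where c': "i' \<in> I" "m' \<in> K \<cdot> ideal_pow ?J r" "c = i' \<oplus> m'"
      by (auto simp: mem_set_add_iff)
    \<comment> \<open>the summand \<open>g \<otimes> c\<close> of \<open>a\<close> gains the missing factor of the power from \<open>g\<close>\<close>
    have "m' \<otimes> g \<in> (K \<cdot> ideal_pow ?J r) \<cdot> ?J"
      using c'(2) gJ by (rule ideal_prod.prod)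
    then have "m' \<otimes> g \<in> ?T (Suc r)"
      using upT(2)[of "Suc r"] unfolding ideal_prod_assoc[OF K pow J] ideal_pow_Suc by blast
    moreover have "i' \<otimes> g \<in> ?T (Suc r)"
      using subsetD[OF upT(1) ideal.I_r_closed[OF I c'(1) g]] .
    moreover have "g \<otimes> c = i' \<otimes> g \<oplus> m' \<otimes> g"
      unfolding c'(3) using ideal.Icarr[OF I c'(1)] ideal.Icarr[OF KJ c'(2)] g by algebra
    ultimately have gc: "g \<otimes> c \<in> ?T (Suc r)"
      by (simp only: ideal_plus_closed[OF T])
    \<comment> \<open>the summand \<open>b\<close>: here \<open>g\<close> is used as an element of \<open>K\<close>\<close>
    obtain i'' v where v: "i'' \<in> I" "v \<in> ideal_pow ?J' (Suc r)" "w = i'' \<oplus> v"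
      using wQ by (auto simp: mem_set_add_iff)
    have "g \<otimes> w = g \<otimes> i'' \<oplus> g \<otimes> v"
      unfolding v(3) using ideal.Icarr[OF I v(1)] ideal.Icarr[OF pow' v(2)] g by algebra
    moreover have "g \<otimes> i'' \<in> ?T'"
      using subsetD[OF upT'(1) ideal.I_l_closed[OF I v(1) g]] .
    moreover have "g \<otimes> v \<in> ?T'"
      using subsetD[OF upT'(2) ideal_prod.prod[OF gK v(2)]] .
    ultimately have "g \<otimes> w \<in> ?T'" by (simp add: ideal_plus_closed[OF T'])
    moreover have "h \<otimes> b = (i \<oplus> u) \<ominus> g \<otimes> w"
      unfolding key[symmetric] using carr g h w by algebra
    ultimately have "h \<otimes> b \<in> ?T'"
      using ideal_minus_closed[OF T' ideal_plus_closed[OF T' subsetD[OF upT'(1) i] subsetD[OF upT'(2) u]]]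
      by simp
    then have "b \<in> ?T'"
      by (intro snoc.IH[OF gs reg K \<open>I \<subseteq> K\<close> gsK h snoc.prems(7) b])
    then show ?case
      unfolding a_eq using ideal_plus_closed[OF T subsetD[OF T'T] gc] by blast
  qed
qed

corollary nonzerodivisor_mod_ideal_pow:
  assumes I: "ideal I R" and gs: "set gs \<subseteq> carrier R" and reg: "weakly_regular_mod I gs"
    and h: "h \<in> carrier R" and nzd: "nonzerodivisor_mod (I <+> Idl (set gs)) h"
  shows "nonzerodivisor_mod (I <+> ideal_pow (Idl (set gs)) r) h"
proof (rule nonzerodivisor_mod_sum_pow[OF I genideal_ideal[OF gs] h])
  let ?J = "Idl (set gs)"
  have J: "ideal ?J R" using gs by (rule genideal_ideal)
  fix r a assume "a \<in> ideal_pow ?J r" "h \<otimes> a \<in> I <+> (I <+> ?J) \<cdot> ideal_pow ?J r"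
  moreover have "I \<subseteq> I <+> ?J" "set gs \<subseteq> I <+> ?J"
    using ideal_sum_upper[OF I J] genideal_self[OF gs] by blast+
  ultimately show "a \<in> I <+> (I <+> ?J) \<cdot> ideal_pow ?J r"
    using nonzerodivisor_mod_ideal_pow_layer[OF I gs reg add_ideals[OF I J] _ _ h nzd] by blast
qed

section \<open>Intersection with powers of an ideal generated by a regular sequence\<close>

text \<open>
  The outer induction removes the last generator and the inner one lowers the exponent. Starting
  from exponent 0, where the equation is $I \cap R = I R$, lets the inner step treat exponent 1
  like all others.
\<close>

theorem inter_ideal_pow_eq_prod:
  assumes I: "ideal I R" and "set gs \<subseteq> carrier R" "weakly_regular_mod I gs"
  shows "I \<inter> ideal_pow (Idl (set gs)) r = I \<cdot> ideal_pow (Idl (set gs)) r"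
proof (rule subset_antisym)
  show "I \<cdot> ideal_pow (Idl (set gs)) r \<subseteq> I \<inter> ideal_pow (Idl (set gs)) r"
    by (intro ideal_prod_inter I ideal_ideal_pow genideal_ideal assms)
  show "I \<inter> ideal_pow (Idl (set gs)) r \<subseteq> I \<cdot> ideal_pow (Idl (set gs)) r"
    using assms(2-)
  proof (induction gs arbitrary: r rule: rev_induct)
    case Nil
    show ?case
    proof (cases r)
      case 0
      then show ?thesis using I by (simp add: ideal_pow_0 ideal_prod_one)
    next
      case (Suc m)
      have J: "ideal (Idl {}) R" by (simp add: genideal_ideal)
      have "ideal_pow (Idl {}) r \<subseteq> {\<zero>}"
        unfolding Suc by (rule ideal_pow_Suc_genideal_empty)
      moreover have "ideal (I \<cdot> ideal_pow (Idl {}) r) R"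
        by (intro I ideal_prod_is_ideal ideal_ideal_pow J)
      ultimately show ?thesis
        by (auto dest!: subsetD simp: additive_subgroup.zero_closed ideal.axioms(1))
    qed
  next
    case (snoc g gs)
    let ?J' = "Idl (set gs)" and ?J = "Idl (set (gs @ [g]))"
    have gs: "set gs \<subseteq> carrier R" and g: "g \<in> carrier R"
      using snoc.prems by auto
    have reg: "weakly_regular_mod I gs" and g_nzd: "nonzerodivisor_mod (I <+> ?J') g"
      using snoc.prems by (auto simp: weakly_regular_mod_snoc)
    have J': "ideal ?J' R" using gs by (rule genideal_ideal)
    have P: "ideal (PIdl g) R" using g by (rule cgenideal_ideal)
    have J_eq: "?J = ?J' <+> PIdl g" using gs g by (rule genideal_snoc)
    have J: "ideal ?J R" unfolding J_eq using J' P by (rule add_ideals)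
    have gJ: "g \<in> ?J" using gs g genideal_self[of "set (gs @ [g])"] by auto
    have J'J: "?J' \<subseteq> ?J" unfolding J_eq using J' P by (rule ideal_sum_upper)
    note pow = ideal_ideal_pow[OF J] and pow' = ideal_ideal_pow[OF J']
    show ?case
    proof (induction r)
      case 0
      then show ?case using I by (simp add: ideal_pow_0 ideal_prod_one)
    next
      case (Suc r)
      show ?case
      proof
        fix f assume f: "f \<in> I \<inter> ideal_pow ?J (Suc r)"
        obtain a b where a: "a \<in> ideal_pow ?J' (Suc r)" and b: "b \<in> ideal_pow ?J r"
          and f_eq: "f = a \<oplus> g \<otimes> b"
          using f mem_ideal_pow_snocE[OF J' g, of f r] unfolding J_eq by blast
        have carr: "a \<in> carrier R" "b \<in> carrier R"
          using ideal.Icarr[OF pow' a] ideal.Icarr[OF pow b] by blast+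
        let ?Q = "I <+> ideal_pow ?J' (Suc r)"
        have Q: "ideal ?Q R" by (intro add_ideals I pow')
        have "g \<otimes> b = f \<ominus> a"
          unfolding f_eq using carr g by algebra
        then have "g \<otimes> b \<in> ?Q"
          using f ideal_minus_closed[OF Q subsetD[OF ideal_sum_upper(1)[OF I pow']]
              subsetD[OF ideal_sum_upper(2)[OF I pow'] a]] by simp
        then have "b \<in> ?Q"
          using nonzerodivisor_mod_ideal_pow[OF I gs reg g g_nzd] carr
          by (simp add: nonzerodivisor_mod_def)
        then obtain c d where c: "c \<in> I" and d: "d \<in> ideal_pow ?J' (Suc r)" and b_eq: "b = c \<oplus> d"
          by (auto simp: mem_set_add_iff)
        have carr': "c \<in> carrier R" "d \<in> carrier R"
          using ideal.Icarr[OF I c] ideal.Icarr[OF pow' d] by blast+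
        have "c = b \<ominus> d" unfolding b_eq using carr' by algebra
        moreover have "d \<in> ideal_pow ?J r"
          using d ideal_pow_Suc_subset[OF J'] ideal_pow_mono[OF J'J] by blast
        ultimately have "c \<in> ideal_pow ?J r" using ideal_minus_closed[OF pow b] by simp
        then have "c \<in> I \<cdot> ideal_pow ?J r" using c Suc.IH by blast
        then have "c \<otimes> g \<in> (I \<cdot> ideal_pow ?J r) \<cdot> ?J"
          using gJ by (rule ideal_prod.prod)
        then have cg: "c \<otimes> g \<in> I \<cdot> ideal_pow ?J (Suc r)"
          by (simp only: ideal_prod_assoc[OF I pow J] ideal_pow_Suc)
        have "a \<oplus> g \<otimes> d = f \<ominus> c \<otimes> g"
          unfolding f_eq b_eq using carr carr' g by algebra
        moreover have "f \<ominus> c \<otimes> g \<in> I"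
          using f ideal_minus_closed[OF I _ ideal.I_r_closed[OF I c g]] by blast
        moreover have "a \<oplus> g \<otimes> d \<in> ideal_pow ?J' (Suc r)"
          using ideal_plus_closed[OF pow' a ideal.I_l_closed[OF pow' d g]] .
        ultimately have "a \<oplus> g \<otimes> d \<in> I \<cdot> ideal_pow ?J' (Suc r)"
          using snoc.IH[OF gs reg] by auto
        then have "a \<oplus> g \<otimes> d \<in> I \<cdot> ideal_pow ?J (Suc r)"
          using ideal_prod_mono[OF order_refl ideal_pow_mono[OF J'J]] by blast
        moreover have "f = (a \<oplus> g \<otimes> d) \<oplus> c \<otimes> g"
          unfolding f_eq b_eq using carr carr' g by algebra
        ultimately show "f \<in> I \<cdot> ideal_pow ?J (Suc r)"
          using cg by (simp only: ideal_plus_closed[OF ideal_prod_is_ideal[OF I pow]])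
      qed
    qed
  qed
qed

section \<open>Regular sequences on a quotient of the ring\<close>

lemma self_module_coset: "I +>\<^bsub>self_module R\<^esub> a = I +> a"
  by (simp add: a_r_coset_def' self_module_def)

lemma carrier_quot_ring: "carrier (quot_module (self_module R) I) = {I +> a |a. a \<in> carrier R}"
  by (auto simp: quot_module_def A_RCOSETS_def' self_module_coset) (auto simp: self_module_def)

lemma smult_quot_ring:
  assumes I: "ideal I R" and "c \<in> carrier R" "a \<in> carrier R"
  shows "c \<odot>\<^bsub>quot_module (self_module R) I\<^esub> (I +> a) = I +> (c \<otimes> a)"
proof -
  interpret S: Module.module R "self_module R" by (rule self_module_is_module)
  have "submodule I R (self_module R)" using I by (simp add: submodule_self_module_iff)
  from S.quot_module_smult_coset[OF this assms(2), of a] assms(3) show ?thesis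
    by (simp add: self_module_coset) (simp add: self_module_def)
qed

text \<open>
  The cosets of elements of $A$ already form a submodule that absorbs $A\,(R/I)$, so the submodule
  generated by these products contains nothing else.
\<close>

lemma ideal_smult_quot_ring_subset:
  assumes I: "ideal I R" and A: "ideal A R"
  shows "ideal_smult R (quot_module (self_module R) I) A \<subseteq> {I +> a |a. a \<in> A}"
proof -
  let ?M = "quot_module (self_module R) I"
  interpret S: Module.module R "self_module R" by (rule self_module_is_module)
  have sub: "submodule I R (self_module R)" using I by (simp add: submodule_self_module_iff)
  interpret M: Module.module R ?M using sub by (rule S.quot_module_is_module)
  interpret I: ideal I R by fact
  let ?N = "{I +> a |a. a \<in> A}"
  have carr: "a \<in> carrier R" if "a \<in> A" for a using A that by (rule ideal.Icarr)
  have smult: "c \<odot>\<^bsub>?M\<^esub> (I +> a) = I +> (c \<otimes> a)" if "c \<in> carrier R" "a \<in> carrier R" for c a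
    using that by (rule smult_quot_ring[OF I])
  have smult_N: "c \<odot>\<^bsub>?M\<^esub> C \<in> ?N" if "c \<in> carrier R" "C \<in> ?N" for c C
    using that carr smult ideal.I_l_closed[OF A] by fastforce
  have N_carr: "?N \<subseteq> carrier ?M"
    using carr by (auto simp: carrier_quot_ring)
  have "submodule ?N R ?M"
  proof (rule M.submoduleI[OF N_carr])
    show "\<zero>\<^bsub>?M\<^esub> \<in> ?N"
      using additive_subgroup.zero_closed[OF ideal.axioms(1)[OF A]] I.a_rcos_const[OF I.zero_closed]
      by (force simp: quot_module_def)
    show "\<ominus>\<^bsub>?M\<^esub> C \<in> ?N" if C: "C \<in> ?N" for C
    proof -
      have "\<ominus>\<^bsub>?M\<^esub> C = (\<ominus> \<one>) \<odot>\<^bsub>?M\<^esub> C"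
        using C N_carr M.smult_l_minus[of \<one> C] by (auto simp: M.smult_one)
      then show ?thesis using smult_N[OF _ C] by simp
    qed
    show "C \<oplus>\<^bsub>?M\<^esub> D \<in> ?N" if "C \<in> ?N" "D \<in> ?N" for C D
    proof -
      from that obtain a b where "a \<in> A" "b \<in> A" "C = I +> a" "D = I +> b" by blast
      then show ?thesis
        using I.a_rcos_sum carr ideal_plus_closed[OF A]
        by (auto simp: quot_module_def self_module_def set_add_defs intro!: exI[of _ "a \<oplus> b"])
    qed
  qed (rule smult_N)
  moreover have "c \<odot>\<^bsub>?M\<^esub> C \<in> ?N" if "c \<in> A" "C \<in> carrier ?M" for c C
    using that carr smult ideal.I_r_closed[OF A] by (fastforce simp: carrier_quot_ring)
  ultimately show ?thesis
    unfolding ideal_smult_def by blast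
qed

text \<open>
  The iterated quotient $(R/I)/A(R/I)$ is $R/(I+A)$: the class of $a$ vanishes in it exactly when
  $a \in I + A$. This turns the conditions in a regular sequence on the module $R/I$ into
  conditions on ideals of $R$.
\<close>

lemma nonzerodivisor_on_quotD:
  assumes I: "ideal I R" and A: "ideal A R" and g: "g \<in> carrier R"
    and nzd: "nonzerodivisor_on
      (quot_module (quot_module (self_module R) I)
        (ideal_smult R (quot_module (self_module R) I) A)) g"
  shows "nonzerodivisor_mod (I <+> A) g"
proof -
  let ?M = "quot_module (self_module R) I"
  let ?N = "ideal_smult R ?M A"
  interpret S: Module.module R "self_module R" by (rule self_module_is_module)
  have sub: "submodule I R (self_module R)" using I by (simp add: submodule_self_module_iff)
  interpret M: Module.module R ?M using sub by (rule S.quot_module_is_module)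
  have "A \<subseteq> carrier R" using A by (auto dest: ideal.Icarr)
  then have N: "submodule ?N R ?M" by (rule M.ideal_smult_is_submodule)
  interpret N: abelian_subgroup ?N ?M using N by (rule M.abelian_subgroup_submodule)
  interpret I: ideal I R by fact
  have in_N: "?N +>\<^bsub>?M\<^esub> (I +> a) = ?N \<longleftrightarrow> a \<in> I <+> A" if a: "a \<in> carrier R" for a
  proof -
    have aM: "I +> a \<in> carrier ?M" using a by (auto simp: carrier_quot_ring)
    have "I +> a \<in> ?N \<longleftrightarrow> a \<in> I <+> A"
    proof
      assume "I +> a \<in> ?N"
      then obtain b where b: "b \<in> A" and "I +> a = I +> b"
        using ideal_smult_quot_ring_subset[OF I A] by blast
      then have "a \<in> I +> b" using I.a_rcos_self[OF a] by simp
      with b show "a \<in> I <+> A" by (auto simp: a_r_coset_def' mem_set_add_iff)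
    next
      assume "a \<in> I <+> A"
      then obtain i b where i: "i \<in> I" and b: "b \<in> A" and a_eq: "a = i \<oplus> b"
        by (auto simp: mem_set_add_iff)
      have bR: "b \<in> carrier R" using A b by (rule ideal.Icarr)
      have "a \<in> I +> b" using i by (auto simp: a_eq a_r_coset_def')
      then have "I +> a = I +> b" using I.a_repr_independence' bR by metis
      also have "\<dots> = b \<odot>\<^bsub>?M\<^esub> (I +> \<one>)" using smult_quot_ring[OF I bR one_closed] bR by simp
      also have "\<dots> \<in> ?N" using b by (auto simp: ideal_smult_def carrier_quot_ring)
      finally show "I +> a \<in> ?N" .
    qed
    moreover have "?N +>\<^bsub>?M\<^esub> (I +> a) = ?N \<longleftrightarrow> I +> a \<in> ?N"
      using N.a_rcos_const N.a_rcos_self[OF aM] by blast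
    ultimately show ?thesis by simp
  qed
  show ?thesis
    unfolding nonzerodivisor_mod_def
  proof (intro ballI impI)
    fix a assume a: "a \<in> carrier R" and ga: "g \<otimes> a \<in> I <+> A"
    let ?x = "?N +>\<^bsub>?M\<^esub> (I +> a)"
    have aM: "I +> a \<in> carrier ?M" using a by (auto simp: carrier_quot_ring)
    then have "?x \<in> carrier (quot_module ?M ?N)"
      by (auto simp: quot_module_def[of ?M] A_RCOSETS_def')
    moreover have "g \<odot>\<^bsub>quot_module ?M ?N\<^esub> ?x = \<zero>\<^bsub>quot_module ?M ?N\<^esub>"
      using M.quot_module_smult_coset[OF N g aM] in_N[of "g \<otimes> a"] ga g a
      by (simp add: smult_quot_ring[OF I] quot_module_def[of ?M])
    ultimately have "?x = \<zero>\<^bsub>quot_module ?M ?N\<^esub>"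
      using nzd by (simp add: nonzerodivisor_on_def)
    then show "a \<in> I <+> A" using in_N[OF a] by (simp add: quot_module_def[of ?M])
  qed
qed

lemma weakly_regular_mod_if_regular_sequence:
  assumes I: "ideal I R" and reg: "regular_sequence R (quot_module (self_module R) I) gs"
  shows "weakly_regular_mod I gs"
proof -
  have gs: "set gs \<subseteq> carrier R" using reg by (simp add: regular_sequence_def)
  then have "ideal (Idl (set (take i gs))) R" for i
    by (intro genideal_ideal) (auto dest: in_set_takeD)
  moreover have "gs ! i \<in> carrier R" if "i < length gs" for i
    using gs that nth_mem by blast
  ultimately show ?thesis
    using reg I by (auto simp: weakly_regular_mod_def regular_sequence_def
        intro!: nonzerodivisor_on_quotD)
qed

end

theorem theorem2p5:
  fixes I J :: "('n::finite, 'k::field) xy_poly set"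
    and gs :: "('n, 'k) xy_poly list"
  assumes "CARD('n) \<ge> 2"
    and "ideal I xy_ring"
    and "ideal J xy_ring"
    and "regular_sequence xy_ring (quot_module (self_module xy_ring) I) gs"
    and "J = Idl\<^bsub>xy_ring\<^esub> (set gs)"
  shows "I \<inter> J = I \<cdot>\<^bsub>xy_ring\<^esub> J \<and>
    (\<forall>r::nat. r > 0 \<longrightarrow>
       I \<inter> (J [^]\<^bsub>ideals_set xy_ring\<^esub> r) = I \<cdot>\<^bsub>xy_ring\<^esub> (J [^]\<^bsub>ideals_set xy_ring\<^esub> r))"
proof -
  interpret cring "xy_ring :: ('n, 'k) xy_poly ring" by (rule cring_xy_ring)
  have gs: "set gs \<subseteq> carrier xy_ring"
    using assms(4) by (simp add: regular_sequence_def)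
  have "weakly_regular_mod I gs"
    using assms(2,4) by (rule weakly_regular_mod_if_regular_sequence)
  then have powers: "I \<inter> ideal_pow J r = I \<cdot>\<^bsub>xy_ring\<^esub> ideal_pow J r" for r
    unfolding assms(5) by (rule inter_ideal_pow_eq_prod[OF assms(2) gs])
  have "ideal_pow J (Suc 0) = J"
    using assms(3) by (simp add: ideal_pow_Suc ideal_pow_0 ideal_prod_one
        ideal_prod_commute[OF oneideal])
  with powers[of "Suc 0"] powers show ?thesis by simp
qed

end
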